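(* Let $t$ be a positive integer. 1. If $k = 4t^2+4t+4$, then there does not exist a $(k^2-k+4s,k)$-modular Golomb ruler for all integers $s$ such that $1\leq s \leq t$ (that is, for each such $s$ no such ruler exists). 2. If $k = 4t^2+4t+2$, then for every integer $s$ with $1\leq s \leq t$ there does not exist a $(k^2-k+4s,k)$-modular Golomb ruler. 3. If $k = 4t^2+3$, then for every integer $s$ with $1\leq s \leq t$ there does not exist a $(k^2-k+4s-2,k)$-modular Golomb ruler. 4. If $k = 4t^2+1$, then for every integer $s$ with $1\leq s \leq t$ there does not exist a $(k^2-k+4s-2,k)$-modular Golomb ruler.
   Context: For an integer $k\ge 3$ and a positive integer $v$, a $(v,k)$-modular Golomb ruler ($(v,k)$-MGR) is a set of $k$ distinct integers $0 \leq x_1 < x_2 < \cdots < x_k \leq v-1$ such that all the differences $x_j - x_i \bmod v$ (over ordered pairs $(i,j)$ with $i \neq j$) are distinct elements of $\mathbb{Z}_v$. *)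

theory Defs
  imports Main
begin

(* The set X = {x_1 < ... < x_k} is the ruler itself; X is finite because it is contained
   in {0..<v}, and Z_v is represented by the least nonnegative residues, i.e. by mod v. *)
definition modular_golomb_ruler :: "nat \<Rightarrow> nat \<Rightarrow> int set \<Rightarrow> bool" where
  "modular_golomb_ruler v k X \<longleftrightarrow>
     3 \<le> k \<and> 0 < v \<and> X \<subseteq> {0..<int v} \<and> card X = k \<and>
     inj_on (\<lambda>(x, y). (y - x) mod int v) {(x, y). x \<in> X \<and> y \<in> X \<and> x \<noteq> y}"

end

theory Submission
  imports Defs
begin

text \<open>
  Let \<open>v\<close> be even, and suppose that a ruler modulo \<open>v\<close> has \<open>a\<close> even and \<open>b\<close> odd elements, with
  \<open>a + b = k\<close>. Reduction modulo \<open>v\<close> preserves parity, so the \<open>2 a b\<close> differences between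
  elements of opposite parity are distinct odd residues, and the \<open>a (a - 1) + b (b - 1)\<close> differences
  between elements of equal parity are distinct nonzero even residues. Hence \<open>2 a b \<le> v / 2\<close> and
  \<open>a (a - 1) + b (b - 1) \<le> v / 2 - 1\<close>. In terms of \<open>d = a - b\<close> these two bounds say
  \[ k^2 - v \le d^2 \le v - 2 + 2 k - k^2, \]
  where \<open>d\<close> has the parity of \<open>k\<close> (lemma \<open>even_modulus_parity_imbalance\<close>).

  When \<open>v\<close> is close to \<open>k\<^sup>2 - k\<close>, this confines \<open>d\<^sup>2\<close> to a short interval around \<open>k\<close>. If the
  interval lies strictly between \<open>n\<^sup>2\<close> and \<open>(n + 2)\<^sup>2\<close> for some \<open>n\<close> with the parity of \<open>k\<close>, then
  no such \<open>d\<close> exists. This happens with \<open>n = 2 t\<close> in the first two families and with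
  \<open>n = 2 t - 1\<close> in the last two.
\<close>

lemma card_odd_residues: "card {z \<in> {0..<2 * int m}. odd z} \<le> m"
proof -
  have "{z \<in> {0..<2 * int m}. odd z} \<subseteq> (\<lambda>i. 2 * int i + 1) ` {0..<m}"
  proof
    fix z assume "z \<in> {z \<in> {0..<2 * int m}. odd z}"
    then have "z = 2 * int (nat (z div 2)) + 1" "nat (z div 2) \<in> {0..<m}"
      by auto
    then show "z \<in> (\<lambda>i. 2 * int i + 1) ` {0..<m}" by blast
  qed
  then have "card {z \<in> {0..<2 * int m}. odd z} \<le> card {0..<m}"
    by (rule surj_card_le[rotated]) simp
  then show ?thesis by simp
qed

lemma card_nonzero_even_residues: "card {z \<in> {0..<2 * int m}. even z \<and> z \<noteq> 0} \<le> m - 1"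
proof -
  have "{z \<in> {0..<2 * int m}. even z \<and> z \<noteq> 0} \<subseteq> (\<lambda>i. 2 * int i) ` {1..<m}"
  proof
    fix z assume "z \<in> {z \<in> {0..<2 * int m}. even z \<and> z \<noteq> 0}"
    then have "z = 2 * int (nat (z div 2))" "nat (z div 2) \<in> {1..<m}"
      by auto
    then show "z \<in> (\<lambda>i. 2 * int i) ` {1..<m}" by blast
  qed
  then have "card {z \<in> {0..<2 * int m}. even z \<and> z \<noteq> 0} \<le> card {1..<m}"
    by (rule surj_card_le[rotated]) simp
  then show ?thesis by simp
qed

lemma card_off_diagonal:
  assumes "finite A"
  shows "int (card {(x, y). x \<in> A \<and> y \<in> A \<and> x \<noteq> y}) = int (card A) * (int (card A) - 1)"
proof -
  have split: "A \<times> A = {(x, y). x \<in> A \<and> y \<in> A \<and> x \<noteq> y} \<union> (\<lambda>x. (x, x)) ` A"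
    by auto
  have "finite {(x, y). x \<in> A \<and> y \<in> A \<and> x \<noteq> y}"
    by (rule finite_subset[of _ "A \<times> A"]) (use assms in auto)
  then have "card (A \<times> A) = card {(x, y). x \<in> A \<and> y \<in> A \<and> x \<noteq> y} + card ((\<lambda>x. (x, x)) ` A)"
    unfolding split by (intro card_Un_disjoint) (use assms in auto)
  also have "card ((\<lambda>x. (x, x)) ` A) = card A"
    by (rule card_image) (simp add: inj_on_def)
  finally have "int (card A) * int (card A)
      = int (card {(x, y). x \<in> A \<and> y \<in> A \<and> x \<noteq> y}) + int (card A)"
    by (simp add: card_cartesian_product flip: of_nat_mult of_nat_add)
  then show ?thesis by (simp add: algebra_simps)
qed

text \<open>
  The number \<open>d\<close> is the number of even elements minus the number of odd elements.
\<close>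
lemma even_modulus_parity_imbalance:
  assumes "modular_golomb_ruler (2 * m) k X"
  obtains d :: int where "even (int k - d)"
    and "int k ^ 2 - 2 * int m \<le> d ^ 2"
    and "d ^ 2 \<le> 2 * int m - 2 + 2 * int k - int k ^ 2"
proof -
  define f where "f = (\<lambda>(x, y). (y - x) mod (2 * int m))"
  define A where "A = {x \<in> X. even x}"
  define B where "B = {x \<in> X. odd x}"
  define P where "P = {(x, y). x \<in> X \<and> y \<in> X \<and> x \<noteq> y}"
  have m: "0 < m" and X: "X \<subseteq> {0..<2 * int m}" and cX: "card X = k" and inj: "inj_on f P"
    using assms by (auto simp: modular_golomb_ruler_def f_def P_def)
  have "finite X" using X finite_subset by blast
  then have fin: "finite A" "finite B" by (auto simp: A_def B_def)
  have "X = A \<union> B" "A \<inter> B = {}" by (auto simp: A_def B_def)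
  then have k: "int k = int (card A) + int (card B)"
    using cX fin by (simp add: card_Un_disjoint)

  have range: "f p \<in> {0..<2 * int m}" for p
    using m by (cases p) (simp add: f_def)
  have parity: "even (f (x, y)) \<longleftrightarrow> even (y - x)" for x y
    by (simp add: f_def dvd_mod_iff)
  have nonzero: "f (x, y) \<noteq> 0" if "(x, y) \<in> P" for x y
  proof
    assume "f (x, y) = 0"
    then have "y mod (2 * int m) = x mod (2 * int m)"
      by (simp add: f_def mod_eq_dvd_iff mod_eq_0_iff_dvd)
    moreover have "x \<in> {0..<2 * int m}" "y \<in> {0..<2 * int m}"
      using that X by (auto simp: P_def)
    ultimately show False using that by (simp add: P_def)
  qed

  have "2 * (card A * card B) = card (A \<times> B \<union> B \<times> A)"
    using fin \<open>A \<inter> B = {}\<close> by (subst card_Un_disjoint) (auto simp: card_cartesian_product)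
  also have "\<dots> = card (f ` (A \<times> B \<union> B \<times> A))"
    by (rule card_image[symmetric], rule inj_on_subset[OF inj]) (auto simp: P_def A_def B_def)
  also have "\<dots> \<le> card {z \<in> {0..<2 * int m}. odd z}"
  proof (rule card_mono)
    show "finite {z \<in> {0..<2 * int m}. odd z}"
      by (rule finite_subset[of _ "{0..<2 * int m}"]) auto
    show "f ` (A \<times> B \<union> B \<times> A) \<subseteq> {z \<in> {0..<2 * int m}. odd z}"
      using range parity by (auto simp: A_def B_def simp del: atLeastLessThan_iff)
  qed
  also have "\<dots> \<le> m" by (rule card_odd_residues)
  finally have "int (2 * (card A * card B)) \<le> int m" by (rule of_nat_mono)
  then have mixed: "2 * (int (card A) * int (card B)) \<le> int m" by simp

  let ?A2 = "{(x, y). x \<in> A \<and> y \<in> A \<and> x \<noteq> y}"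
  let ?B2 = "{(x, y). x \<in> B \<and> y \<in> B \<and> x \<noteq> y}"
  have fin2: "finite ?A2" "finite ?B2"
    using fin by (auto intro: finite_subset[of _ "A \<times> A"] finite_subset[of _ "B \<times> B"])
  have sub: "?A2 \<union> ?B2 \<subseteq> P" by (auto simp: P_def A_def B_def)
  have "card ?A2 + card ?B2 = card (?A2 \<union> ?B2)"
    using fin2 \<open>A \<inter> B = {}\<close> by (subst card_Un_disjoint) auto
  also have "\<dots> = card (f ` (?A2 \<union> ?B2))"
    by (rule card_image[symmetric], rule inj_on_subset[OF inj sub])
  also have "\<dots> \<le> card {z \<in> {0..<2 * int m}. even z \<and> z \<noteq> 0}"
  proof (rule card_mono)
    show "finite {z \<in> {0..<2 * int m}. even z \<and> z \<noteq> 0}"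
      by (rule finite_subset[of _ "{0..<2 * int m}"]) auto
    show "f ` (?A2 \<union> ?B2) \<subseteq> {z \<in> {0..<2 * int m}. even z \<and> z \<noteq> 0}"
    proof
      fix z assume "z \<in> f ` (?A2 \<union> ?B2)"
      then obtain x y where xy: "(x, y) \<in> ?A2 \<union> ?B2" and z: "z = f (x, y)" by auto
      have "even (y - x)" using xy by (auto simp: A_def B_def)
      moreover have "(x, y) \<in> P" using xy sub by blast
      ultimately show "z \<in> {z \<in> {0..<2 * int m}. even z \<and> z \<noteq> 0}"
        using range[of "(x, y)"] parity[of x y] nonzero[of x y] z
        by (simp del: atLeastLessThan_iff)
    qed
  qed
  also have "\<dots> \<le> m - 1" by (rule card_nonzero_even_residues)
  finally have "int (card ?A2) + int (card ?B2) \<le> int m - 1" using m by linarith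
  then have pure: "int (card A) * (int (card A) - 1) + int (card B) * (int (card B) - 1) \<le> int m - 1"
    by (simp add: card_off_diagonal fin)

  show thesis
  proof
    show "even (int k - (int (card A) - int (card B)))" by (simp add: k)
    show "int k ^ 2 - 2 * int m \<le> (int (card A) - int (card B)) ^ 2"
      using mixed by (simp add: k power2_eq_square algebra_simps)
    show "(int (card A) - int (card B)) ^ 2 \<le> 2 * int m - 2 + 2 * int k - int k ^ 2"
      using pure by (simp add: k power2_eq_square algebra_simps)
  qed
qed

lemma no_square_between_of_same_parity:
  fixes n d :: int
  assumes "0 \<le> n" "even (n - d)" "n ^ 2 < d ^ 2" "d ^ 2 < (n + 2) ^ 2"
  shows False
proof -
  have "n < \<bar>d\<bar>"
    using assms(3) by (intro power2_less_imp_less[of n "\<bar>d\<bar>"]) auto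
  moreover have "\<bar>d\<bar> < n + 2"
    using assms(1,4) by (intro power2_less_imp_less[of "\<bar>d\<bar>" "n + 2"]) auto
  ultimately have "\<bar>d\<bar> = n + 1" by linarith
  then show False using assms(2) by presburger
qed

text \<open>
  The modulus is written \<open>k\<^sup>2 - k + r\<close>; it is even when \<open>r\<close> is. The two strict inequalities say
  that the interval \<open>[k - r, k + r - 2]\<close> lies strictly between \<open>n\<^sup>2\<close> and \<open>(n + 2)\<^sup>2\<close>.
\<close>
lemma no_ruler_if_between_squares:
  fixes k r n :: nat
  assumes "even r" "even (int n - int k)"
    and "int n ^ 2 < int k - int r" "int k + int r - 2 < (int n + 2) ^ 2"
  shows "\<not> modular_golomb_ruler (k ^ 2 - k + r) k X"
proof
  assume ruler: "modular_golomb_ruler (k ^ 2 - k + r) k X"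
  have "k \<le> k ^ 2" by (simp add: power2_eq_square)
  then have v: "int (k ^ 2 - k + r) = int k ^ 2 - int k + int r" by (simp add: of_nat_diff)
  have "even (int (k ^ 2 - k + r))" using assms(1) unfolding v by simp
  then have "even (k ^ 2 - k + r)" by (simp only: even_of_nat_iff)
  then obtain m where m: "k ^ 2 - k + r = 2 * m" by (rule evenE)
  then have m': "2 * int m = int k ^ 2 - int k + int r" using v by simp
  obtain d where "even (int k - d)"
    and "int k ^ 2 - 2 * int m \<le> d ^ 2"
    and "d ^ 2 \<le> 2 * int m - 2 + 2 * int k - int k ^ 2"
    using even_modulus_parity_imbalance ruler unfolding m by blast
  then show False
    using assms(2-4) m' by (intro no_square_between_of_same_parity[of "int n" d]) auto
qed

theorem theorem3p9:
  fixes t k :: nat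
  assumes "0 < t"
  shows "(k = 4 * t^2 + 4 * t + 4 \<longrightarrow>
            (\<forall>s::nat. 1 \<le> s \<and> s \<le> t \<longrightarrow> \<not> (\<exists>X. modular_golomb_ruler (k^2 - k + 4 * s) k X))) \<and>
         (k = 4 * t^2 + 4 * t + 2 \<longrightarrow>
            (\<forall>s::nat. 1 \<le> s \<and> s \<le> t \<longrightarrow> \<not> (\<exists>X. modular_golomb_ruler (k^2 - k + 4 * s) k X))) \<and>
         (k = 4 * t^2 + 3 \<longrightarrow>
            (\<forall>s::nat. 1 \<le> s \<and> s \<le> t \<longrightarrow> \<not> (\<exists>X. modular_golomb_ruler (k^2 - k + 4 * s - 2) k X))) \<and>
         (k = 4 * t^2 + 1 \<longrightarrow>
            (\<forall>s::nat. 1 \<le> s \<and> s \<le> t \<longrightarrow> \<not> (\<exists>X. modular_golomb_ruler (k^2 - k + 4 * s - 2) k X)))"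
proof (intro conjI impI allI notI; elim exE conjE)
  fix s X
  assume k: "k = 4 * t^2 + 4 * t + 4" and s: "s \<le> t"
    and "modular_golomb_ruler (k^2 - k + 4 * s) k X"
  then show False
    using no_ruler_if_between_squares[of "4 * s" "2 * t" k X]
    by (auto simp: power2_eq_square algebra_simps)
next
  fix s X
  assume k: "k = 4 * t^2 + 4 * t + 2" and s: "s \<le> t"
    and "modular_golomb_ruler (k^2 - k + 4 * s) k X"
  then show False
    using no_ruler_if_between_squares[of "4 * s" "2 * t" k X]
    by (auto simp: power2_eq_square algebra_simps)
next
  fix s X
  assume k: "k = 4 * t^2 + 3" and s: "1 \<le> s" "s \<le> t"
    and ruler: "modular_golomb_ruler (k^2 - k + 4 * s - 2) k X"
  \<comment> \<open>As \<open>1 \<le> s \<le> t\<close>, the truncated subtractions below are exact.\<close>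
  have "k^2 - k + 4 * s - 2 = k^2 - k + (4 * s - 2)" using s by simp
  moreover have "int (2 * t - 1) = 2 * int t - 1" "int (4 * s - 2) = 4 * int s - 2"
    using s by auto
  ultimately show False
    using no_ruler_if_between_squares[of "4 * s - 2" "2 * t - 1" k X] k s ruler
    by (auto simp: power2_eq_square algebra_simps)
next
  fix s X
  assume k: "k = 4 * t^2 + 1" and s: "1 \<le> s" "s \<le> t"
    and ruler: "modular_golomb_ruler (k^2 - k + 4 * s - 2) k X"
  \<comment> \<open>As \<open>1 \<le> s \<le> t\<close>, the truncated subtractions below are exact.\<close>
  have "k^2 - k + 4 * s - 2 = k^2 - k + (4 * s - 2)" using s by simp
  moreover have "int (2 * t - 1) = 2 * int t - 1" "int (4 * s - 2) = 4 * int s - 2"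
    using s by auto
  ultimately show False
    using no_ruler_if_between_squares[of "4 * s - 2" "2 * t - 1" k X] k s ruler
    by (auto simp: power2_eq_square algebra_simps)
qed

end
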